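(* SimplE cannot enforce non-trivial subsumptions. That is, for every integer $k\ge1$, there do not exist relation embeddings $\mathbf r=[\mathbf r^+,\mathbf r^-]$ and $\mathbf s=[\mathbf s^+,\mathbf s^-]$ with $\mathbf r^\pm,\mathbf s^\pm\in\mathbb R^k$ such that both (i) $\mu(\mathbf h,\mathbf s,\mathbf t)\ge\mu(\mathbf h,\mathbf r,\mathbf t)$ for all entity embeddings $\mathbf h=[\mathbf h^+,\mathbf h^-]$, $\mathbf t=[\mathbf t^+,\mathbf t^-]$ with $\mathbf h^\pm,\mathbf t^\pm\in\mathbb R^k$, and (ii) there exist entity embeddings $\mathbf a=[\mathbf a^+,\mathbf a^-]$, $\mathbf b=[\mathbf b^+,\mathbf b^-]$ with $\mathbf a^\pm,\mathbf b^\pm\in\mathbb R^k$ and $\mu(\mathbf a,\mathbf s,\mathbf b)>\mu(\mathbf a,\mathbf r,\mathbf b)$, where $\mu$ is the SimplE score function.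
   Context: For vectors $\mathbf x,\mathbf y,\mathbf z\in\mathbb R^k$, write $\langle \mathbf x,\mathbf y,\mathbf z\rangle=\sum_{\ell=1}^k x_\ell y_\ell z_\ell$. In the SimplE model with embedding size $k$, each entity $e$ has an embedding $\mathbf e=[\mathbf e^+,\mathbf e^-]$, where $\mathbf e^+\in\mathbb R^k$ is its embedding as a head and $\mathbf e^-\in\mathbb R^k$ its embedding as a tail, and each relation $r$ has an embedding $\mathbf r=[\mathbf r^+,\mathbf r^-]$, where $\mathbf r^+\in\mathbb R^k$ is the forward embedding and $\mathbf r^-\in\mathbb R^k$ the embedding of its inverse. All such real vectors are legal entity embeddings. The probability assigned to a triple (head $h$, relation $r$, tail $t$) is $$\mu(\mathbf h,\mathbf r,\mathbf t)=\sigma\left(\tfrac12\left(\langle\mathbf h^+,\mathbf r^+,\mathbf t^-\rangle+\langle\mathbf t^+,\mathbf r^-,\mathbf h^-\rangle\right)\right),\qquad \sigma(x)=\frac1{1+e^{-x}}.$$ A subsumption states that relation $r$ is a subproperty of relation $s$: $(h,r,t)\rightarrow(h,s,t)$ for all possible entities $h,t$, i.e. all those with a legal embedding. A model enforces it if $\mu(\mathbf h,\mathbf r,\mathbf t)\le\mu(\mathbf h,\mathbf s,\mathbf t)$ for all legal entity embeddings $\mathbf h,\mathbf t$. It is non-trivial if it is not symmetric, i.e. the inequality is strict for some pair of legal entity embeddings. *)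

theory Defs
  imports "HOL-Analysis.Analysis"
begin

(* The embedding size is k = CARD('k); k >= 1 since types are nonempty. *)

(* (e_plus, e_minus): embeddings of the entity as head and as tail *)
type_synonym 'k entity_emb = "(real ^ 'k) \<times> (real ^ 'k)"

(* (r_plus, r_minus): embeddings of the relation and of its inverse *)
type_synonym 'k relation_emb = "(real ^ 'k) \<times> (real ^ 'k)"

definition triple_prod :: "real ^ ('k::finite) \<Rightarrow> real ^ 'k \<Rightarrow> real ^ 'k \<Rightarrow> real" where
  "triple_prod x y z = (\<Sum>l\<in>UNIV. x $ l * y $ l * z $ l)"

definition sigmoid :: "real \<Rightarrow> real" where
  "sigmoid x = 1 / (1 + exp (- x))"

definition simple_score :: "('k::finite) entity_emb \<Rightarrow> 'k relation_emb \<Rightarrow> 'k entity_emb \<Rightarrow> real" where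
  "simple_score h r t =
     sigmoid (1 / 2 * (triple_prod (fst h) (fst r) (snd t) + triple_prod (fst t) (snd r) (snd h)))"

definition enforces_subsumption :: "('k::finite) relation_emb \<Rightarrow> 'k relation_emb \<Rightarrow> bool" where
  "enforces_subsumption r s \<longleftrightarrow>
     (\<forall>h t :: 'k entity_emb. simple_score h r t \<le> simple_score h s t)"

definition nontrivial_subsumption :: "('k::finite) relation_emb \<Rightarrow> 'k relation_emb \<Rightarrow> bool" where
  "nontrivial_subsumption r s \<longleftrightarrow>
     (\<exists>a b :: 'k entity_emb. simple_score a r b < simple_score a s b)"

end

(* Negating the head embedding negates the argument of the sigmoid, so it replaces every score p
   by 1 - p. Hence an inequality of scores that holds for all heads also holds reversed, and
   cannot be strict anywhere. *)

theory Submission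
  imports Defs
begin

lemma sigmoid_minus: "sigmoid (- x) = 1 - sigmoid x"
proof -
  \<comment> \<open>With nonzero denominators the fractions can be cleared; what is left rests on
    \<open>exp x * exp (- x) = 1\<close>.\<close>
  have "1 + exp x \<noteq> 0" "1 + exp (- x) \<noteq> 0"
    using exp_gt_zero[of x] exp_gt_zero[of "- x"] by linarith+
  then show ?thesis
    by (simp add: sigmoid_def field_simps flip: exp_add)
qed

lemma triple_prod_minus_left: "triple_prod (- x) y z = - triple_prod x y z"
  by (simp add: triple_prod_def sum_negf)

lemma triple_prod_minus_right: "triple_prod x y (- z) = - triple_prod x y z"
  by (simp add: triple_prod_def sum_negf)

text \<open>Each of the two triple products contains exactly one component of \<open>h\<close>:
  \<open>fst h\<close> in the first slot, \<open>snd h\<close> in the third. Negation of a pair is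
  componentwise, so both products change sign.\<close>

lemma simple_score_minus_head: "simple_score (- h) r t = 1 - simple_score h r t"
  by (simp add: simple_score_def triple_prod_minus_left triple_prod_minus_right
      add_divide_distrib diff_divide_distrib flip: sigmoid_minus)

theorem theorem3:
  shows "\<not> (\<exists>r s :: ('k::finite) relation_emb.
            enforces_subsumption r s \<and> nontrivial_subsumption r s)"
proof
  assume "\<exists>r s :: 'k relation_emb. enforces_subsumption r s \<and> nontrivial_subsumption r s"
  then obtain r s :: "'k relation_emb" and a b :: "'k entity_emb"
    where le: "\<And>h t :: 'k entity_emb. simple_score h r t \<le> simple_score h s t"
      and less: "simple_score a r b < simple_score a s b"
    unfolding enforces_subsumption_def nontrivial_subsumption_def by blast
  \<comment> \<open>At head \<open>- a\<close> the inequality becomes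
    \<open>simple_score a s b \<le> simple_score a r b\<close>.\<close>
  from le[of "- a" b] less show False
    by (simp add: simple_score_minus_head)
qed

end
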